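(* Let $\Phi:\mathbb R\to\mathbb R$, $\Phi(x)=x^2$, $\Phi^*=0$, and $r\in(0,1)$. Let $\{\xi_k:k\ge1\}$ be independent Bernoulli ($\{0,1\}$-valued) random variables with $\mathbb P(\xi_k=1)=2^{-(2k-1)}$, and define $X^0=1$, $X^{k+1}=r\,\xi_{k+1}X^k$, $\mathcal F_k:=\sigma(\xi_1,\dots,\xi_k)$, $\mathbb E_k[\cdot]:=\mathbb E[\cdot\mid\mathcal F_k]$, $D_k:=|X^{k+1}-X^k|$, and $p_{k+1}:=\mathbb P(\xi_{k+1}=1)$. Then, for all $k\in\mathbb N$: (a) $\mathbb E_k[\Phi(X^{k+1})+D_k^2]=\bigl(1-2p_{k+1}r(1-r)\bigr)\Phi(X^k)\le\Phi(X^k)$ almost surely; (b) $\operatorname{dist}(0,\partial\Phi(X^k))=2|X^k|\le 2D_k/(1-r)$; (c) on every sample path, $\sum_{k=0}^\infty D_k=1$ and $X^k\to0$; (d) $\Phi$ has KL exponent $1/2$ at $0$; (e) $\mathbb E[\Phi(X^k)-\Phi^*]=2^{-k^2}r^{2k}$ and $\mathbb E[\operatorname{dist}(0,\partial\Phi(X^k))]=2^{1-k^2}r^k$; hence for every $\theta\in[0,1)$, every $a>0$ and $\varphi(s)=as^{1-\theta}$, $$\varphi'\bigl(\mathbb E[\Phi(X^k)-\Phi^*]\bigr)\,\mathbb E[\operatorname{dist}(0,\partial\Phi(X^k))]=2a(1-\theta)2^{-(1-\theta)k^2}r^{(1-2\theta)k}\longrightarrow0\quad(k\to\infty).$$ Consequently,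 no iteration-independent power-type function $\varphi(s)=as^{1-\theta}$ with $a>0$ and any $\theta\in[0,1)$ satisfies the expected-KL inequality $\varphi'\bigl(\mathbb E[\Phi(X^k)-\Phi^*]\bigr)\,\mathbb E[\operatorname{dist}(0,\partial\Phi(X^k))]\ge1$ along this sequence.
   Context: $\mathbb N=\{0,1,2,\dots\}$. Here $\partial\Phi(x)=\{\Phi'(x)\}=\{2x\}$ and $\operatorname{dist}(0,S)=\inf_{y\in S}|y|$. A function $\phi$ has KL exponent $\theta\in[0,1)$ at $\bar x$ if there are $c,\varepsilon,\delta>0$ such that with $\varphi(s)=cs^{1-\theta}$ one has $\varphi'(\phi(x)-\phi(\bar x))\operatorname{dist}(0,\partial\phi(x))\ge1$ for all $x$ with $\|x-\bar x\|<\delta$ and $\phi(\bar x)<\phi(x)<\phi(\bar x)+\varepsilon$. *)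

theory Defs
  imports "HOL-Probability.Probability"
begin

definition frechet_subdifferential :: "('a::euclidean_space \<Rightarrow> real) \<Rightarrow> 'a \<Rightarrow> 'a set" where
  "frechet_subdifferential f x =
     {v. 0 \<le> Liminf (at x) (\<lambda>y. ereal ((f y - f x - v \<bullet> (y - x)) / norm (y - x)))}"

text \<open>The limiting (Mordukhovich) subdifferential, which is the subdifferential usually meant in
  the Kurdyka--Lojasiewicz inequality. For a continuously differentiable function it is the
  singleton of the gradient; see \<open>subdifferential_Phi\<close> below.\<close>

definition subdifferential :: "('a::euclidean_space \<Rightarrow> real) \<Rightarrow> 'a \<Rightarrow> 'a set" where
  "subdifferential f x =
     {v. \<exists>xs vs. xs \<longlonglongrightarrow> x \<and> (\<lambda>n. f (xs n)) \<longlonglongrightarrow> f x \<and>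
           (\<forall>n. vs n \<in> frechet_subdifferential f (xs n)) \<and> vs \<longlonglongrightarrow> v}"

definition power_desing :: "real \<Rightarrow> real \<Rightarrow> real \<Rightarrow> real" where
  "power_desing c \<theta> s = c * s powr (1 - \<theta>)"

text \<open>The distance to the empty set is \<open>\<infinity>\<close> by the usual convention, so that the inequality holds
  trivially at points with empty subdifferential; since \<^const>\<open>infdist\<close> to the empty set is 0,
  those points are excluded explicitly.\<close>

definition has_KL_exponent :: "('a::euclidean_space \<Rightarrow> real) \<Rightarrow> real \<Rightarrow> 'a \<Rightarrow> bool" where
  "has_KL_exponent f \<theta> xbar \<longleftrightarrow>
     0 \<le> \<theta> \<and> \<theta> < 1 \<and>
     (\<exists>c \<epsilon> \<delta>. c > 0 \<and> \<epsilon> > 0 \<and> \<delta> > 0 \<and>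
        (\<forall>x. norm (x - xbar) < \<delta> \<and> f xbar < f x \<and> f x < f xbar + \<epsilon> \<and> subdifferential f x \<noteq> {} \<longrightarrow>
           deriv (power_desing c \<theta>) (f x - f xbar) * infdist 0 (subdifferential f x) \<ge> 1))"

definition Phi :: "real \<Rightarrow> real" where
  "Phi x = x\<^sup>2"

definition Phi_star :: real where
  "Phi_star = 0"

fun X :: "real \<Rightarrow> (nat \<Rightarrow> 'w \<Rightarrow> real) \<Rightarrow> nat \<Rightarrow> 'w \<Rightarrow> real" where
  "X r \<xi> 0 \<omega> = 1"
| "X r \<xi> (Suc k) \<omega> = r * \<xi> (Suc k) \<omega> * X r \<xi> k \<omega>"

definition D :: "real \<Rightarrow> (nat \<Rightarrow> 'w \<Rightarrow> real) \<Rightarrow> nat \<Rightarrow> 'w \<Rightarrow> real" where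
  "D r \<xi> k \<omega> = \<bar>X r \<xi> (Suc k) \<omega> - X r \<xi> k \<omega>\<bar>"

definition past :: "'w measure \<Rightarrow> (nat \<Rightarrow> 'w \<Rightarrow> real) \<Rightarrow> nat \<Rightarrow> 'w measure" where
  "past M \<xi> k = sigma (space M) {\<xi> i -` A \<inter> space M | i A. i \<in> {1..k} \<and> A \<in> sets borel}"

lemma frechet_subdifferential_Phi: "frechet_subdifferential Phi x = {2 * x}"
proof (intro equalityI subsetI)
  fix v assume v: "v \<in> frechet_subdifferential Phi x"
  define q where "q y = (Phi y - Phi x - v * (y - x)) / \<bar>y - x\<bar>" for y
  have L: "0 \<le> Liminf (at x) (\<lambda>y. ereal (q y))"
    using v by (simp add: frechet_subdifferential_def q_def)
  have ev: "eventually (\<lambda>y. - e \<le> q y) (at x)" if "e > 0" for e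
  proof -
    have "eventually (\<lambda>y. ereal (- e) < ereal (q y)) (at x)"
      using L[unfolded le_Liminf_iff, rule_format, of "ereal (- e)"] that by simp
    then show ?thesis by (rule eventually_mono) auto
  qed
  have evR: "eventually (\<lambda>y. - e \<le> y + x - v) (at_right x)" if "e > 0" for e
  proof -
    have "eventually (\<lambda>y. - e \<le> q y) (at_right x)"
      using ev[OF that] by (simp add: eventually_at_split)
    moreover have "eventually (\<lambda>y. y > x) (at_right x)"
      by (simp add: eventually_at_right_less)
    ultimately show ?thesis
    proof eventually_elim
      case (elim y)
      then have "q y = ((y - x) * (y + x - v)) / (y - x)"
        by (simp add: q_def Phi_def power2_eq_square algebra_simps)
      with elim show ?case by simp
    qed
  qed
  have evL: "eventually (\<lambda>y. - e \<le> v - y - x) (at_left x)" if "e > 0" for e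
  proof -
    have "eventually (\<lambda>y. - e \<le> q y) (at_left x)"
      using ev[OF that] by (simp add: eventually_at_split)
    moreover have "eventually (\<lambda>y. y < x) (at_left x)"
      by (simp add: eventually_at_filter)
    ultimately show ?thesis
    proof eventually_elim
      case (elim y)
      then have "q y = ((x - y) * (v - y - x)) / (x - y)"
        by (simp add: q_def Phi_def power2_eq_square algebra_simps)
      with elim show ?case by simp
    qed
  qed
  have r: "- e \<le> x + x - v" if "e > 0" for e
  proof (rule tendsto_lowerbound[OF _ evR[OF that]])
    show "((\<lambda>y. y + x - v) \<longlongrightarrow> x + x - v) (at_right x)" by (intro tendsto_intros)
  qed simp
  have l: "- e \<le> v - x - x" if "e > 0" for e
  proof (rule tendsto_lowerbound[OF _ evL[OF that]])
    show "((\<lambda>y. v - y - x) \<longlongrightarrow> v - x - x) (at_left x)" by (intro tendsto_intros)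
  qed simp
  have "v \<le> 2 * x"
  proof (rule field_le_epsilon)
    show "v \<le> 2 * x + e" if "e > 0" for e using r[OF that] by linarith
  qed
  moreover have "2 * x \<le> v"
  proof (rule field_le_epsilon)
    show "2 * x \<le> v + e" if "e > 0" for e using l[OF that] by linarith
  qed
  ultimately show "v \<in> {2 * x}" by simp
next
  fix v assume "v \<in> {2 * x}"
  then have v: "v = 2 * x" by simp
  have "0 \<le> Phi y - Phi x - v * (y - x)" for y
    using zero_le_power2[of "y - x"]
    by (simp add: v Phi_def power2_eq_square algebra_simps)
  then have "\<forall>y. 0 \<le> ereal ((Phi y - Phi x - v * (y - x)) / \<bar>y - x\<bar>)"
    by simp
  then show "v \<in> frechet_subdifferential Phi x"
    by (auto simp: frechet_subdifferential_def intro!: Liminf_bounded)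
qed

lemma subdifferential_Phi: "subdifferential Phi x = {2 * x}"
proof (intro equalityI subsetI)
  fix v assume "v \<in> subdifferential Phi x"
  then obtain xs vs where xs: "xs \<longlonglongrightarrow> x" "\<And>n. vs n = 2 * xs n" "vs \<longlonglongrightarrow> v"
    by (auto simp: subdifferential_def frechet_subdifferential_Phi)
  have "vs \<longlonglongrightarrow> 2 * x"
    using tendsto_mult_left[OF xs(1), of 2] by (subst tendsto_cong[where g = "\<lambda>n. 2 * xs n"]) (auto simp: xs(2))
  with xs(3) show "v \<in> {2 * x}" using LIMSEQ_unique by auto
next
  fix v assume "v \<in> {2 * x}"
  then have "\<exists>vs. (\<lambda>_::nat. x) \<longlonglongrightarrow> x \<and> (\<lambda>_::nat. Phi x) \<longlonglongrightarrow> Phi x \<and>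
      (\<forall>n. vs n \<in> {2 * x}) \<and> vs \<longlonglongrightarrow> v"
    by (intro exI[of _ "\<lambda>_. 2 * x"]) simp
  then show "v \<in> subdifferential Phi x"
    unfolding subdifferential_def frechet_subdifferential_Phi
    by - (rule CollectI, rule exI[of _ "\<lambda>_. x"])
qed

end

(* Since X k depends only on the first k Bernoulli variables, it is independent of the next
   one, so every expectation needed here is a product; in particular E[X k ^ m] is r^(mk) times the
   product of the p_i = 2^-(2i-1), which is 2^-(k^2) for every m >= 1.  As the first and the second
   moment carry the same factor 2^-(k^2), the expected-KL product retains the factor
   2^-((1-theta)k^2), which no geometric factor in k can compensate. *)
theory Submission
  imports Defs "HOL-Real_Asymp.Real_Asymp"
begin

section \<open>Deterministic facts on \<open>Phi\<close>, power functions and the final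
  limit\<close>

lemma deriv_power_desing:
  assumes "0 < s"
  shows "deriv (power_desing c \<theta>) s = c * (1 - \<theta>) * s powr (- \<theta>)"
proof (rule DERIV_imp_deriv)
  have "((\<lambda>s. c * s powr (1 - \<theta>)) has_real_derivative c * (1 - \<theta>) * s powr (- \<theta>)) (at s)"
    using DERIV_cmult[OF has_real_derivative_powr[OF assms, of "1 - \<theta>"], of c]
    by (simp add: mult.assoc)
  then show "(power_desing c \<theta> has_real_derivative c * (1 - \<theta>) * s powr (- \<theta>)) (at s)"
    by (simp add: power_desing_def[abs_def])
qed

lemma infdist_subdifferential_Phi: "infdist 0 (subdifferential Phi x) = 2 * \<bar>x\<bar>"
  by (simp add: subdifferential_Phi infdist_def dist_real_def abs_mult)

text \<open>The square root has derivative 1/(2|x|) at \<open>x\<^sup>2\<close>, which cancels the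
  distance 2|x| exactly, so the KL product equals 1 at every nonzero point.\<close>

lemma has_KL_exponent_Phi: "has_KL_exponent Phi (1 / 2) 0"
proof -
  have "1 \<le> deriv (power_desing 1 (1 / 2)) (Phi x - Phi 0) * infdist 0 (subdifferential Phi x)"
    if "Phi 0 < Phi x" for x
  proof -
    have "x \<noteq> 0" using that by auto
    then have "(x\<^sup>2) powr (- (1 / 2)) = 1 / \<bar>x\<bar>"
      by (simp add: powr_minus_divide powr_half_sqrt)
    then show ?thesis
      using \<open>x \<noteq> 0\<close>
      by (simp add: Phi_def deriv_power_desing infdist_subdifferential_Phi)
  qed
  then show ?thesis
    \<comment> \<open>The single instantiation serves \<open>c\<close>, \<open>\<epsilon>\<close>
      and \<open>\<delta>\<close>. The bound above is global, so any positive radii would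
      do.\<close>
    unfolding has_KL_exponent_def by (intro conjI exI[of _ 1]) auto
qed

text \<open>Written with \<open>exp\<close>, the exponent is
  \<open>d * real k - c * (real k)\<^sup>2\<close> with \<open>c\<close> positive, and the quadratic
  term wins whatever the sign of \<open>d\<close>. This is needed for \<open>s\<close> = 1 - 2
  \<open>\<theta>\<close> with \<open>\<theta>\<close> above 1/2, where the power of
  \<open>r\<close> grows with \<open>k\<close>.\<close>

lemma gaussian_times_geometric_tendsto_0:
  fixes b r s \<theta> :: real
  assumes "\<theta> < 1" "0 < r"
  shows "(\<lambda>k. b * 2 powr (- (1 - \<theta>) * (real k)\<^sup>2) * r powr (s * real k)) \<longlonglongrightarrow> 0"
proof -
  define c where "c = (1 - \<theta>) * ln 2"
  define d where "d = s * ln r"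
  have "0 < c" using assms by (simp add: c_def)
  then have "(\<lambda>k. b * exp (d * real k - c * (real k)\<^sup>2)) \<longlonglongrightarrow> 0"
    by real_asymp
  moreover have "b * 2 powr (- (1 - \<theta>) * (real k)\<^sup>2) * r powr (s * real k)
      = b * exp (d * real k - c * (real k)\<^sup>2)" for k
    using assms by (simp add: powr_def c_def d_def exp_add[symmetric] algebra_simps)
  ultimately show ?thesis by (simp only:)
qed

section \<open>The recursion, its filtration, and independence of the next variable\<close>

locale bernoulli_contraction = prob_space M
  for M :: "'w measure" and \<xi> :: "nat \<Rightarrow> 'w \<Rightarrow> real" and r :: real +
  assumes r_pos: "0 < r" and r_less_1: "r < 1"
    and indep: "indep_vars (\<lambda>_. borel) \<xi> {1..}"
    and binary: "\<And>k \<omega>. k \<ge> 1 \<Longrightarrow> \<omega> \<in> space M \<Longrightarrow> \<xi> k \<omega> \<in> {0, 1}"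
begin

lemma xi_measurable: "k \<ge> 1 \<Longrightarrow> \<xi> k \<in> borel_measurable M"
  using indep by (auto simp: indep_vars_def)

lemma space_past [simp]: "space (past M \<xi> k) = space M"
  unfolding past_def by (rule space_measure_of) auto

text \<open>Splitting the generator by index gives the shape in which
  \<open>indep_sets_collect_sigma\<close> delivers sigma-algebras of blocks.\<close>

lemma sets_past:
  "sets (past M \<xi> k)
    = sigma_sets (space M) (\<Union>i\<in>{1..k}. {\<xi> i -` A \<inter> space M | A. A \<in> sets borel})"
proof -
  have "{\<xi> i -` A \<inter> space M | i A. i \<in> {1..k} \<and> A \<in> sets borel}
      = (\<Union>i\<in>{1..k}. {\<xi> i -` A \<inter> space M | A. A \<in> sets borel})"
    by blast
  then show ?thesis
    unfolding past_def by (subst sets_measure_of) auto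
qed

lemma subalgebra_past: "subalgebra M (past M \<xi> k)"
  unfolding subalgebra_def sets_past
  by (auto intro!: sets.sigma_sets_subset measurable_sets[OF xi_measurable])

lemma xi_past_measurable: "1 \<le> i \<Longrightarrow> i \<le> k \<Longrightarrow> \<xi> i \<in> borel_measurable (past M \<xi> k)"
  by (rule measurableI) (auto simp: sets_past intro!: sigma_sets.Basic UN_I[of i])

lemma X_past_measurable: "j \<le> k \<Longrightarrow> X r \<xi> j \<in> borel_measurable (past M \<xi> k)"
proof (induction j)
  case (Suc j)
  then have "(\<lambda>\<omega>. r * \<xi> (Suc j) \<omega> * X r \<xi> j \<omega>) \<in> borel_measurable (past M \<xi> k)"
    by (intro borel_measurable_times borel_measurable_const xi_past_measurable) auto
  then show ?case by (simp add: X.simps(2)[abs_def])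
qed (simp add: X.simps(1)[abs_def])

lemma X_measurable [measurable]: "X r \<xi> k \<in> borel_measurable M"
  using measurable_from_subalg[OF subalgebra_past X_past_measurable[OF order_refl]] .

text \<open>The index blocks {1..k} and {k+1} are disjoint, so the sigma-algebras they generate are
  independent. \<open>Y\<close> ranges over all variables measurable for the past, because
  conditioning later requires \<open>X r \<xi> k\<close> multiplied by indicators of past
  events.\<close>

lemma indep_var_past_next:
  assumes "Y \<in> borel_measurable (past M \<xi> k)"
  shows "indep_var borel Y borel (\<xi> (Suc k))"
proof -
  define E where "E i = {\<xi> i -` A \<inter> space M | A. A \<in> sets borel}" for i
  \<comment> \<open>The blocks are indexed by booleans because \<open>indep_set\<close> is
    independence of a family over \<open>bool\<close>.\<close>
  define I where "I = case_bool {1..k} {Suc k}"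
  have "indep_sets (\<lambda>b. sigma_sets (space M) (\<Union>i\<in>I b. E i)) UNIV"
  proof (rule indep_sets_collect_sigma)
    have "indep_sets E {1..}"
      using indep unfolding indep_vars_def2 E_def by auto
    then show "indep_sets E (\<Union>b\<in>UNIV. I b)"
      by (rule indep_sets_mono_index[rotated]) (auto simp: I_def UNIV_bool)
    show "disjoint_family_on I UNIV"
      by (auto simp: disjoint_family_on_def I_def split: bool.splits)
    show "Int_stable (E i)" for i
    proof (rule Int_stableI)
      fix a b assume "a \<in> E i" "b \<in> E i"
      then obtain A B where "a = \<xi> i -` A \<inter> space M" "b = \<xi> i -` B \<inter> space M"
        "A \<in> sets borel" "B \<in> sets borel"
        by (auto simp: E_def)
      then show "a \<inter> b \<in> E i"
        by (auto simp: E_def intro!: exI[of _ "A \<inter> B"])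
    qed
  qed
  then have "indep_set (sets (past M \<xi> k)) (sigma_sets (space M) (E (Suc k)))"
    unfolding indep_set_def
    by (rule indep_sets_mono_sets) (auto simp: I_def sets_past E_def split: bool.splits)
  \<comment> \<open>Independence passes from the whole past to the smaller sigma-algebra generated
    by \<open>Y\<close>.\<close>
  moreover have "sigma_sets (space M) {Y -` A \<inter> space M | A. A \<in> sets borel} \<subseteq> sets (past M \<xi> k)"
    using measurable_sets[OF assms]
    by (auto intro!: sets.sigma_sets_subset[of _ "past M \<xi> k", unfolded space_past])
  ultimately have "indep_set (sigma_sets (space M) {Y -` A \<inter> space M | A. A \<in> sets borel})
      (sigma_sets (space M) (E (Suc k)))"
    unfolding indep_set_def by (elim indep_sets_mono_sets) (auto split: bool.splits)
  then show ?thesis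
    using measurable_from_subalg[OF subalgebra_past assms] xi_measurable[of "Suc k"]
    by (simp add: indep_var_eq E_def)
qed

abbreviation p :: "nat \<Rightarrow> real" where
  "p k \<equiv> prob {\<omega> \<in> space M. \<xi> k \<omega> = 1}"

text \<open>Being binary identifies each variable with an indicator, so integrability is immediate
  and the mean is the success probability.\<close>

lemma xi_eq_indicator:
  "k \<ge> 1 \<Longrightarrow> \<omega> \<in> space M \<Longrightarrow> \<xi> k \<omega> = indicator {\<omega> \<in> space M. \<xi> k \<omega> = 1} \<omega>"
  using binary[of k \<omega>] by (auto simp: indicator_def)

lemma
  assumes "k \<ge> 1"
  shows integrable_xi: "integrable M (\<xi> k)" and expectation_xi: "expectation (\<xi> k) = p k"
proof -
  have [measurable]: "\<xi> k \<in> borel_measurable M" by (rule xi_measurable[OF assms])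
  have "integrable M (indicator {\<omega> \<in> space M. \<xi> k \<omega> = 1} :: 'w \<Rightarrow> real)"
    by (intro integrable_real_indicator) (auto simp: emeasure_eq_measure)
  then show "integrable M (\<xi> k)"
    by (subst Bochner_Integration.integrable_cong[OF refl xi_eq_indicator[OF assms]]) auto
  show "expectation (\<xi> k) = p k"
    by (subst Bochner_Integration.integral_cong[OF refl xi_eq_indicator[OF assms]]) auto
qed

lemma expectation_past_times_next:
  assumes "Y \<in> borel_measurable (past M \<xi> k)" "integrable M Y"
  shows "expectation (\<lambda>\<omega>. Y \<omega> * \<xi> (Suc k) \<omega>) = expectation Y * p (Suc k)"
  using indep_var_lebesgue_integral[OF indep_var_past_next[OF assms(1)] assms(2) integrable_xi]
  by (simp add: expectation_xi)

section \<open>Bounds and convergence on every sample path\<close>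

lemma X_nonneg: "\<omega> \<in> space M \<Longrightarrow> 0 \<le> X r \<xi> k \<omega>"
proof (induction k)
  case (Suc k)
  then show ?case using binary[of "Suc k" \<omega>] r_pos by auto
qed simp

lemma X_le_power: "\<omega> \<in> space M \<Longrightarrow> X r \<xi> k \<omega> \<le> r ^ k"
proof (induction k)
  case (Suc k)
  then show ?case using binary[of "Suc k" \<omega>] r_pos by auto
qed simp

lemma X_le_1: "\<omega> \<in> space M \<Longrightarrow> X r \<xi> k \<omega> \<le> 1"
  using X_le_power[of \<omega> k] power_le_one[of r k] r_pos r_less_1 by simp

lemma D_eq:
  assumes "\<omega> \<in> space M"
  shows "D r \<xi> k \<omega> = X r \<xi> k \<omega> - X r \<xi> (Suc k) \<omega>"
proof -
  have "r * X r \<xi> k \<omega> \<le> X r \<xi> k \<omega>"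
    using mult_right_mono[of r 1 "X r \<xi> k \<omega>"] r_less_1 X_nonneg[OF assms] by simp
  then show ?thesis
    using binary[of "Suc k" \<omega>] assms X_nonneg[OF assms, of k] by (auto simp: D_def)
qed

text \<open>On success the step length is exactly (1 - r) times the current value; on failure it is
  the whole current value, which is at least as large.\<close>

lemma X_le_D:
  assumes "\<omega> \<in> space M"
  shows "(1 - r) * X r \<xi> k \<omega> \<le> D r \<xi> k \<omega>"
  using binary[of "Suc k" \<omega>] assms X_nonneg[OF assms, of k] r_pos
  by (auto simp: D_eq algebra_simps)

lemma X_tendsto_0:
  assumes "\<omega> \<in> space M"
  shows "(\<lambda>k. X r \<xi> k \<omega>) \<longlonglongrightarrow> 0"
proof (rule tendsto_sandwich[where f = "\<lambda>_. 0" and h = "\<lambda>k. r ^ k"])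
  show "(\<lambda>k. r ^ k) \<longlonglongrightarrow> 0" using r_pos r_less_1 by (intro LIMSEQ_realpow_zero) auto
qed (use assms X_nonneg X_le_power in auto)

lemma D_sums_1: "\<omega> \<in> space M \<Longrightarrow> (\<lambda>k. D r \<xi> k \<omega>) sums 1"
  \<comment> \<open>The sum is the initial value 1 minus the limit 0. The recursion stays folded so
    that consecutive terms keep the telescoping form.\<close>
  using telescope_sums'[OF X_tendsto_0] by (simp add: D_eq del: X.simps(2))

section \<open>Moments and conditional descent\<close>

lemma integrable_X_power: "integrable M (\<lambda>\<omega>. X r \<xi> k \<omega> ^ m)"
  by (rule integrable_const_bound[where B = 1])
     (auto simp: power_abs[symmetric] X_nonneg X_le_1 intro!: power_le_one)

lemma expectation_X_power:
  assumes "m \<ge> 1"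
  shows "expectation (\<lambda>\<omega>. X r \<xi> k \<omega> ^ m) = (\<Prod>i\<in>{1..k}. p i) * r ^ (m * k)"
proof (induction k)
  case (Suc k)
  \<comment> \<open>Idempotence of 0 and 1 under positive powers is why the product of the
    \<open>p i\<close> does not depend on \<open>m\<close>; this is the use of
    \<open>m \<ge> 1\<close>.\<close>
  have "\<xi> (Suc k) \<omega> ^ m = \<xi> (Suc k) \<omega>" if "\<omega> \<in> space M" for \<omega>
    using binary[of "Suc k" \<omega>] that assms by auto
  then have "expectation (\<lambda>\<omega>. X r \<xi> (Suc k) \<omega> ^ m)
      = expectation (\<lambda>\<omega>. r ^ m * (X r \<xi> k \<omega> ^ m * \<xi> (Suc k) \<omega>))"
    by (intro Bochner_Integration.integral_cong) (auto simp: power_mult_distrib)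
  also have "\<dots> = r ^ m * (expectation (\<lambda>\<omega>. X r \<xi> k \<omega> ^ m) * p (Suc k))"
    using X_past_measurable[of k k]
    by (simp add: expectation_past_times_next integrable_X_power)
  finally show ?case
    by (simp add: Suc.IH power_add)
qed (simp add: prob_space)

text \<open>For \<open>\<xi>\<close> = 1 this is r^2 + (1 - r)^2 = 1 - 2r(1 - r); for
  \<open>\<xi>\<close> = 0 the squared step recovers all of \<open>Phi\<close>. The right side is
  affine in the new variable, so conditioning will only need its mean.\<close>

lemma descent_identity:
  assumes "\<omega> \<in> space M"
  shows "Phi (X r \<xi> (Suc k) \<omega>) + (D r \<xi> k \<omega>)\<^sup>2
    = Phi (X r \<xi> k \<omega>) - 2 * r * (1 - r) * (Phi (X r \<xi> k \<omega>) * \<xi> (Suc k) \<omega>)"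
  using binary[of "Suc k" \<omega>] assms
  by (auto simp: Phi_def D_def power2_eq_square algebra_simps)

text \<open>The conditional expectation is identified by its integrals over past events, where
  independence replaces the new variable by its mean.\<close>

lemma conditional_descent:
  "AE \<omega> in M. real_cond_exp M (past M \<xi> k) (\<lambda>\<omega>. Phi (X r \<xi> (Suc k) \<omega>) + (D r \<xi> k \<omega>)\<^sup>2) \<omega>
    = (1 - 2 * p (Suc k) * r * (1 - r)) * Phi (X r \<xi> k \<omega>)"
proof -
  let ?F = "past M \<xi> k" and ?f = "\<lambda>\<omega>. Phi (X r \<xi> (Suc k) \<omega>) + (D r \<xi> k \<omega>)\<^sup>2"
  define c where "c = 2 * r * (1 - r)"
  interpret finite_measure_subalgebra M ?F
    by unfold_locales (rule subalgebra_past)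
  have Phi_F [measurable]: "(\<lambda>\<omega>. Phi (X r \<xi> k \<omega>)) \<in> borel_measurable ?F"
    using X_past_measurable[of k k] by (simp add: Phi_def)
  have int_Phi: "integrable M (\<lambda>\<omega>. Phi (X r \<xi> k \<omega>))"
    using integrable_X_power[of k 2] by (simp add: Phi_def)
  have int_Phi_xi: "integrable M (\<lambda>\<omega>. Phi (X r \<xi> k \<omega>) * \<xi> (Suc k) \<omega>)"
    by (rule indep_var_integrable[OF indep_var_past_next[OF Phi_F] int_Phi integrable_xi]) simp
  have "AE \<omega> in M. real_cond_exp M ?F ?f \<omega> = (1 - c * p (Suc k)) * Phi (X r \<xi> k \<omega>)"
  proof (rule real_cond_exp_charact)
    fix A assume A: "A \<in> sets ?F"
    \<comment> \<open>Absorbing the indicator of \<open>A\<close> keeps the factor measurable for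
      the past, so \<open>expectation_past_times_next\<close> applies to it.\<close>
    define Y where "Y \<omega> = indicator A \<omega> * Phi (X r \<xi> k \<omega>)" for \<omega>
    have AM: "A \<in> sets M" using A subalgebra_past by (auto simp: subalgebra_def)
    have Y_F: "Y \<in> borel_measurable ?F" using A unfolding Y_def by measurable
    have int_Y: "integrable M Y"
      using integrable_mult_indicator[OF AM int_Phi] by (simp add: Y_def[abs_def])
    have int_Yxi: "integrable M (\<lambda>\<omega>. Y \<omega> * \<xi> (Suc k) \<omega>)"
      using integrable_mult_indicator[OF AM int_Phi_xi] by (simp add: Y_def[abs_def] mult.assoc)
    have "(LINT \<omega>:A|M. ?f \<omega>) = (LINT \<omega>|M. Y \<omega> - c * (Y \<omega> * \<xi> (Suc k) \<omega>))"
      unfolding set_lebesgue_integral_def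
      by (rule Bochner_Integration.integral_cong)
         (auto simp only: descent_identity Y_def c_def real_scaleR_def algebra_simps)
    also have "\<dots> = expectation Y - c * (expectation Y * p (Suc k))"
      using int_Y int_Yxi by (simp add: expectation_past_times_next[OF Y_F int_Y])
    also have "\<dots> = (LINT \<omega>|M. (1 - c * p (Suc k)) * Y \<omega>)"
      by (simp only: integral_mult_right_zero) (simp add: algebra_simps)
    also have "\<dots> = (LINT \<omega>:A|M. (1 - c * p (Suc k)) * Phi (X r \<xi> k \<omega>))"
      unfolding set_lebesgue_integral_def Y_def by (simp add: mult_ac)
    finally show "(LINT \<omega>:A|M. ?f \<omega>) = (LINT \<omega>:A|M. (1 - c * p (Suc k)) * Phi (X r \<xi> k \<omega>))" .
  next
    have "integrable M (\<lambda>\<omega>. Phi (X r \<xi> k \<omega>) - c * (Phi (X r \<xi> k \<omega>) * \<xi> (Suc k) \<omega>))"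
      using int_Phi int_Phi_xi by auto
    then show "integrable M ?f"
      by (subst Bochner_Integration.integrable_cong[OF refl descent_identity])
         (auto simp: c_def)
  qed (use int_Phi in auto)
  then show ?thesis by (simp only: c_def mult_ac)
qed

lemma conditional_descent_le:
  "(1 - 2 * p (Suc k) * r * (1 - r)) * Phi (X r \<xi> k \<omega>) \<le> Phi (X r \<xi> k \<omega>)"
proof -
  have "0 \<le> 2 * p (Suc k) * r * (1 - r)" "0 \<le> Phi (X r \<xi> k \<omega>)"
    using r_pos r_less_1 by (auto simp: Phi_def)
  then have "0 \<le> (2 * p (Suc k) * r * (1 - r)) * Phi (X r \<xi> k \<omega>)"
    by (rule mult_nonneg_nonneg)
  then show ?thesis by (simp add: left_diff_distrib)
qed

end

section \<open>The prescribed success probabilities and the expected-KL product\<close>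

locale fast_bernoulli_contraction = bernoulli_contraction +
  assumes success: "\<And>k. k \<ge> 1 \<Longrightarrow> p k = 2 powr (- (2 * real k - 1))"
begin

text \<open>The exponents add up the first \<open>k\<close> odd numbers, whose sum is k^2.\<close>

lemma prod_success: "(\<Prod>i\<in>{1..k}. p i) = 2 powr (- (real k)\<^sup>2)"
proof (induction k)
  case (Suc k)
  then have "(\<Prod>i\<in>{1..Suc k}. p i) = 2 powr (- (real k)\<^sup>2 + - (2 * real (Suc k) - 1))"
    by (simp only: powr_add) (simp add: success)
  then show ?case by (simp add: power2_eq_square algebra_simps)
qed simp

lemma expectation_Phi:
  "expectation (\<lambda>\<omega>. Phi (X r \<xi> k \<omega>) - Phi_star) = 2 powr (- (real k)\<^sup>2) * r ^ (2 * k)"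
  using expectation_X_power[of 2 k, unfolded prod_success] by (simp add: Phi_def Phi_star_def)

lemma expectation_infdist:
  "expectation (\<lambda>\<omega>. infdist 0 (subdifferential Phi (X r \<xi> k \<omega>)))
    = 2 powr (1 - (real k)\<^sup>2) * r ^ k"
proof -
  have "expectation (\<lambda>\<omega>. infdist 0 (subdifferential Phi (X r \<xi> k \<omega>)))
      = expectation (\<lambda>\<omega>. 2 * X r \<xi> k \<omega> ^ 1)"
    by (intro Bochner_Integration.integral_cong)
       (auto simp: infdist_subdifferential_Phi X_nonneg)
  also have "\<dots> = 2 * (2 powr (- (real k)\<^sup>2) * r ^ k)"
    using expectation_X_power[of 1 k, unfolded prod_success] by simp
  finally show ?thesis by (simp add: powr_diff powr_minus_divide)
qed

text \<open>Positivity of \<open>r\<close> makes the expected gap strictly positive, so the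
  derivative formula applies; the rest collects the exponents of 2 and of \<open>r\<close>
  separately.\<close>

lemma expected_KL_product:
  "deriv (power_desing a \<theta>) (expectation (\<lambda>\<omega>. Phi (X r \<xi> k \<omega>) - Phi_star))
      * expectation (\<lambda>\<omega>. infdist 0 (subdifferential Phi (X r \<xi> k \<omega>)))
    = 2 * a * (1 - \<theta>) * 2 powr (- (1 - \<theta>) * (real k)\<^sup>2) * r powr ((1 - 2 * \<theta>) * real k)"
proof -
  have "(2 powr (- (real k)\<^sup>2) * r ^ (2 * k)) powr (- \<theta>) * (2 powr (1 - (real k)\<^sup>2) * r ^ k)
      = (2 powr (\<theta> * (real k)\<^sup>2) * 2 powr (1 - (real k)\<^sup>2))
        * (r powr (- 2 * \<theta> * real k) * r powr real k)"
    using r_pos by (simp add: powr_mult powr_powr powr_realpow[symmetric] mult_ac)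
  also have "\<dots> = 2 powr (1 + - (1 - \<theta>) * (real k)\<^sup>2) * r powr ((1 - 2 * \<theta>) * real k)"
    by (simp only: powr_add[symmetric]) (simp add: algebra_simps)
  also have "\<dots> = 2 * 2 powr (- (1 - \<theta>) * (real k)\<^sup>2) * r powr ((1 - 2 * \<theta>) * real k)"
    by (simp only: powr_add) simp
  finally show ?thesis
    using r_pos by (simp add: expectation_Phi expectation_infdist deriv_power_desing mult_ac)
qed

end

theorem mainTheorem2:
  fixes M :: "'w measure" and \<xi> :: "nat \<Rightarrow> 'w \<Rightarrow> real" and r :: real
  assumes "prob_space M"
    and "0 < r" and "r < 1"
    and "prob_space.indep_vars M (\<lambda>_. borel) \<xi> {1..}"
    and "\<And>k \<omega>. k \<ge> 1 \<Longrightarrow> \<omega> \<in> space M \<Longrightarrow> \<xi> k \<omega> \<in> {0, 1}"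
    and "\<And>k. k \<ge> 1 \<Longrightarrow> measure M {\<omega> \<in> space M. \<xi> k \<omega> = 1} = 2 powr (- (2 * real k - 1))"
  shows
    \<comment> \<open>(a)\<close>
    "(\<forall>k. AE \<omega> in M.
        real_cond_exp M (past M \<xi> k) (\<lambda>\<omega>'. Phi (X r \<xi> (k + 1) \<omega>') + (D r \<xi> k \<omega>')\<^sup>2) \<omega>
          = (1 - 2 * measure M {\<omega>' \<in> space M. \<xi> (k + 1) \<omega>' = 1} * r * (1 - r)) * Phi (X r \<xi> k \<omega>)
        \<and> (1 - 2 * measure M {\<omega>' \<in> space M. \<xi> (k + 1) \<omega>' = 1} * r * (1 - r)) * Phi (X r \<xi> k \<omega>)
          \<le> Phi (X r \<xi> k \<omega>))
    \<and> \<comment> \<open>(b)\<close>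
     (\<forall>k. \<forall>\<omega>\<in>space M.
        infdist 0 (subdifferential Phi (X r \<xi> k \<omega>)) = 2 * \<bar>X r \<xi> k \<omega>\<bar>
        \<and> 2 * \<bar>X r \<xi> k \<omega>\<bar> \<le> 2 * D r \<xi> k \<omega> / (1 - r))
    \<and> \<comment> \<open>(c)\<close>
     (\<forall>\<omega>\<in>space M. (\<lambda>k. D r \<xi> k \<omega>) sums 1 \<and> (\<lambda>k. X r \<xi> k \<omega>) \<longlonglongrightarrow> 0)
    \<and> \<comment> \<open>(d)\<close>
     has_KL_exponent Phi (1 / 2) 0
    \<and> \<comment> \<open>(e)\<close>
     (\<forall>k. (LINT \<omega>|M. Phi (X r \<xi> k \<omega>) - Phi_star) = 2 powr (- (real k)\<^sup>2) * r ^ (2 * k)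
        \<and> (LINT \<omega>|M. infdist 0 (subdifferential Phi (X r \<xi> k \<omega>)))
            = 2 powr (1 - (real k)\<^sup>2) * r ^ k)
    \<and> (\<forall>\<theta> a. 0 \<le> \<theta> \<and> \<theta> < 1 \<and> a > 0 \<longrightarrow>
        (\<forall>k. deriv (power_desing a \<theta>) (LINT \<omega>|M. Phi (X r \<xi> k \<omega>) - Phi_star)
               * (LINT \<omega>|M. infdist 0 (subdifferential Phi (X r \<xi> k \<omega>)))
             = 2 * a * (1 - \<theta>) * 2 powr (- (1 - \<theta>) * (real k)\<^sup>2) * r powr ((1 - 2 * \<theta>) * real k))
        \<and> (\<lambda>k. 2 * a * (1 - \<theta>) * 2 powr (- (1 - \<theta>) * (real k)\<^sup>2) * r powr ((1 - 2 * \<theta>) * real k))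
             \<longlonglongrightarrow> 0)
    \<and> \<comment> \<open>no power-type function satisfies the expected-KL inequality\<close>
     \<not> (\<exists>a \<theta>. a > 0 \<and> 0 \<le> \<theta> \<and> \<theta> < 1 \<and>
        (\<forall>k. deriv (power_desing a \<theta>) (LINT \<omega>|M. Phi (X r \<xi> k \<omega>) - Phi_star)
               * (LINT \<omega>|M. infdist 0 (subdifferential Phi (X r \<xi> k \<omega>))) \<ge> 1))"
proof -
  interpret fast_bernoulli_contraction M \<xi> r
    using assms
    by (intro fast_bernoulli_contraction.intro bernoulli_contraction.intro
        bernoulli_contraction_axioms.intro fast_bernoulli_contraction_axioms.intro) auto
  let ?KL = "\<lambda>a \<theta> k. deriv (power_desing a \<theta>) (LINT \<omega>|M. Phi (X r \<xi> k \<omega>) - Phi_star)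
               * (LINT \<omega>|M. infdist 0 (subdifferential Phi (X r \<xi> k \<omega>)))"
  let ?R = "\<lambda>a \<theta> k. 2 * a * (1 - \<theta>) * 2 powr (- (1 - \<theta>) * (real k)\<^sup>2)
               * r powr ((1 - 2 * \<theta>) * real k)"
  have b: "2 * \<bar>X r \<xi> k \<omega>\<bar> \<le> 2 * D r \<xi> k \<omega> / (1 - r)" if "\<omega> \<in> space M" for k \<omega>
    using X_le_D[OF that, of k] X_nonneg[OF that, of k] r_less_1
    by (simp add: field_simps)
  have lim: "?R a \<theta> \<longlonglongrightarrow> 0" if "\<theta> < 1" for a \<theta>
    using gaussian_times_geometric_tendsto_0[OF that r_pos] .
  \<comment> \<open>A sequence bounded below by 1 cannot tend to 0.\<close>
  have no_KL: "\<not> (\<forall>k. 1 \<le> ?KL a \<theta> k)" if "\<theta> < 1" for a \<theta>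
  proof
    assume "\<forall>k. 1 \<le> ?KL a \<theta> k"
    moreover have "?KL a \<theta> \<longlonglongrightarrow> 0"
      unfolding expected_KL_product by (rule lim[OF that])
    ultimately have "(1::real) \<le> 0" by (intro LIMSEQ_le_const) auto
    then show False by simp
  qed
  show ?thesis
  proof (intro conjI)
    show "\<not> (\<exists>a \<theta>. a > 0 \<and> 0 \<le> \<theta> \<and> \<theta> < 1 \<and> (\<forall>k. ?KL a \<theta> k \<ge> 1))"
      using no_KL by blast
    show "\<forall>\<theta> a. 0 \<le> \<theta> \<and> \<theta> < 1 \<and> a > 0 \<longrightarrow>
        (\<forall>k. ?KL a \<theta> k = ?R a \<theta> k) \<and> ?R a \<theta> \<longlonglongrightarrow> 0"
      using expected_KL_product lim by blast
  \<comment> \<open>The distance formula is used from right to left so that the integrands keep the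
    form required by \<open>expectation_infdist\<close>; \<open>X.simps\<close> is removed so that
    the next iterate stays folded as in \<open>conditional_descent\<close>.\<close>
  qed (use conditional_descent conditional_descent_le b in
      \<open>simp_all del: X.simps add: infdist_subdifferential_Phi[symmetric] D_sums_1 X_tendsto_0
        has_KL_exponent_Phi expectation_Phi expectation_infdist\<close>)
qed

end
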